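(* Let $\omega = e^{i\pi/3}$ and $\rho = 2$, and let $R(0)$ be the marked regular hexagon described in the context. Consider the limiting relation $$\rho R = R \cup (1+\omega^5 R)\cup(\omega + R)\cup(\omega^2+\omega^4 R)\cup(\omega^3+\omega^2 R)\cup(\omega^4+R)\cup(\omega^5+\omega R),$$ understood as the limit of the recursion $$\rho R(n) = R(n-1) \cup (1+\omega^5 R(n-1))\cup(\omega + R(n-1))\cup(\omega^2+\omega^4 R(n-1))\cup(\omega^3+\omega^2 R(n-1))\cup(\omega^4+R(n-1))\cup(\omega^5+\omega R(n-1)),\qquad n\ge 1,$$ started at $R(0)$. This relation describes an aperiodic tiling of the plane. That is, let $P_n$ be the finite collection of marked hexagons that make up $2^nR(n)$, and let $P_\infty=\bigcup_{n\ge 0}P_n$, with overlaid (coinciding) marked hexagons identified. Then $P_\infty$ is a tiling of $\mathbb{C}$ by marked hexagons, and there is no nonzero $t\in\mathbb{C}$ such that the translation $z\mapsto z+t$ maps the marked tiling $P_\infty$ onto itself.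
   Context: The plane is identified with $\mathbb{C}$, with its Euclidean metric and Lebesgue measure. Two subsets are essentially disjoint if their intersection has measure $0$. They are essentially identical if both sets and their intersection have equal measure. A tiling of the plane by congruent copies of a tile is a cover of the plane by translated, rotated and possibly reflected copies that are pairwise essentially disjoint. An over-tiling is a cover by such copies that are pairwise essentially disjoint or essentially identical, so several copies of a tile may occupy the same position. The tiling corresponding to an over-tiling is obtained by identifying overlaid tiles. Marked hexagon. $H$ is the closed regular hexagon centered at $0$ with vertices $\frac{1}{\sqrt3}e^{i(\pi/6+k\pi/3)}$, $0\le k\le5$. Thus the translates of $H$ by $\mathbb{Z}[\omega]$ tile the plane, and the centers of the hexagons adjacent to $H$ are the numbers $\omega^k$. The marked hexagon $R(0)$ is the pair $(H,c)$, where $c$ is a chord joining two vertices of $H$ that are separated by one intermediate vertex, and $c$ is positioned so that complex conjugation acts on the marked hexagon as multiplication by $\omega^5$, i.e. $\overline{c}=\omega^5c$. Explicitly, $c$ is the segment joining $\frac1{\sqrt3}e^{-i\pi/6}$ and $\frac1{\sqrt3}e^{i\pi/2}$, or the segment joining $\frac1{\sqrt3}e^{5i\pi/6}$ and $\frac1{\sqrt3}e^{3i\pi/2}$. The statement is made for a fixed choice of either one. For $a,u\in\mathbb{C}$ with $|u|=1$, the marked hexagon $a+u(H,c)$ is $(a+uH,\,a+uc)$. Two marked hexagons coincide if both their hexagons and their chords coincide. Meaning of the recursion. Let $(c_j,u_j)$, $0\le j\le 6$, be the pairs $(0,1),(1,\omega^5),(\omega,1),(\omega^2,\omega^4),(\omega^3,\omega^2),(\omega^4,1),(\omega^5,\omega)$.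 Multiplying the recursion by $2^{n-1}$ gives the collections of unit-scale marked hexagons $$P_0=\{R(0)\},\qquad P_n=\bigcup_{j=0}^{6}\{\,2^{n-1}c_j+u_jT : T\in P_{n-1}\,\}\quad(n\ge1).$$ Here $P_n$ is the collection of marked hexagons whose union is $2^nR(n)$. Since $(c_0,u_0)=(0,1)$, one has $P_{n-1}\subset P_n$. A marked tiling is a set of marked hexagons whose underlying hexagons form a tiling. It is aperiodic if no nonzero translation maps it, including its chords, onto itself. *)

theory Defs
  imports "HOL-Analysis.Analysis"
begin

definition essentially_disjoint :: "complex set \<Rightarrow> complex set \<Rightarrow> bool" where
  "essentially_disjoint A B \<longleftrightarrow> A \<inter> B \<in> null_sets lebesgue"

definition congruent_copy :: "complex set \<Rightarrow> complex set \<Rightarrow> bool" where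
  "congruent_copy X Y \<longleftrightarrow>
     (\<exists>a u. cmod u = 1 \<and> (Y = (\<lambda>z. a + u * z) ` X \<or> Y = (\<lambda>z. a + u * cnj z) ` X))"

(* The family is indexed, so that two different members occupying the same position
   violate essential disjointness. *)
definition tiling_by_copies :: "complex set \<Rightarrow> 'i set \<Rightarrow> ('i \<Rightarrow> complex set) \<Rightarrow> bool" where
  "tiling_by_copies X I f \<longleftrightarrow>
     (\<forall>i\<in>I. congruent_copy X (f i)) \<and>
     (\<Union>i\<in>I. f i) = UNIV \<and>
     (\<forall>i\<in>I. \<forall>j\<in>I. i \<noteq> j \<longrightarrow> essentially_disjoint (f i) (f j))"

definition \<omega> :: complex where
  "\<omega> = exp (\<i> * of_real (pi / 3))"

definition hex_vertex :: "real \<Rightarrow> complex" where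
  "hex_vertex \<theta> = of_real (1 / sqrt 3) * exp (\<i> * of_real \<theta>)"

definition H :: "complex set" where
  "H = convex hull {hex_vertex (pi / 6 + real k * pi / 3) | k. k \<le> (5::nat)}"

(* The two admissible positions of the chord. *)
definition marking_chords :: "complex set set" where
  "marking_chords =
     {closed_segment (hex_vertex (- pi / 6)) (hex_vertex (pi / 2)),
      closed_segment (hex_vertex (5 * pi / 6)) (hex_vertex (3 * pi / 2))}"

(* A marked hexagon is a pair (hexagon, chord). *)
type_synonym marked_hexagon = "complex set \<times> complex set"

definition place :: "complex \<Rightarrow> complex \<Rightarrow> marked_hexagon \<Rightarrow> marked_hexagon" where
  "place a u T = ((\<lambda>z. a + u * z) ` fst T, (\<lambda>z. a + u * z) ` snd T)"

definition marked_hexagons :: "complex set \<Rightarrow> marked_hexagon set" where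
  "marked_hexagons c = {place a u (H, c) | a u. cmod u = 1}"

definition recursion_pairs :: "(complex \<times> complex) set" where
  "recursion_pairs =
     {(0, 1), (1, \<omega> ^ 5), (\<omega>, 1), (\<omega> ^ 2, \<omega> ^ 4), (\<omega> ^ 3, \<omega> ^ 2), (\<omega> ^ 4, 1), (\<omega> ^ 5, \<omega>)}"

(* P c n is the collection of unit-scale marked hexagons making up 2^n R(n),
   where R(0) = (H, c). *)
primrec P :: "complex set \<Rightarrow> nat \<Rightarrow> marked_hexagon set" where
  "P c 0 = {(H, c)}"
| "P c (Suc n) = (\<Union>(d, u)\<in>recursion_pairs. place (2 ^ n * d) u ` P c n)"

definition P_inf :: "complex set \<Rightarrow> marked_hexagon set" where
  "P_inf c = (\<Union>n. P c n)"

definition marked_tiling :: "complex set \<Rightarrow> marked_hexagon set \<Rightarrow> bool" where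
  "marked_tiling c \<T> \<longleftrightarrow> \<T> \<subseteq> marked_hexagons c \<and> tiling_by_copies H \<T> fst"

definition aperiodic :: "marked_hexagon set \<Rightarrow> bool" where
  "aperiodic \<T> \<longleftrightarrow> \<not> (\<exists>t. t \<noteq> 0 \<and> place t 1 ` \<T> = \<T>)"

end

theory Submission
  imports Defs
begin

text \<open>
  The underlying hexagons are the translates of \<open>H\<close> by the Eisenstein integers, so only the
  orientations matter. Instead of placing seven copies of a patch, one can scale up by two and
  replace every single tile by seven tiles. Put an arrow on every edge of a tile, outgoing on three
  edges and incoming on three edges. The tile that the substitution puts at the midpoint of two
  adjacent centres depends only on the arrow between them, and if the arrows of adjacent tiles agree
  they also agree after the substitution. Hence coinciding tiles of a patch always have the same
  orientation. A translation by a point outside twice the lattice is no period, because the tiles at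
  the midpoints with a given direction show only two opposite orientations; a period in twice the
  lattice can be halved, so there is none except zero.
\<close>

subsection \<open>The Eisenstein lattice\<close>

lemma Re_omega [simp]: "Re \<omega> = 1 / 2" and Im_omega [simp]: "Im \<omega> = sqrt 3 / 2"
  by (simp_all add: \<omega>_def Re_exp Im_exp cos_60 sin_60)

lemma omega_sq: "\<omega>\<^sup>2 = \<omega> - 1"
  by (simp add: complex_eq_iff power2_eq_square)

lemma omega_mult: "\<omega> * \<omega> = \<omega> - 1"
  using omega_sq by (simp add: power2_eq_square)

lemma omega_pow3: "\<omega> ^ 3 = -1" and omega_pow4: "\<omega> ^ 4 = - \<omega>"
  and omega_pow5: "\<omega> ^ 5 = 1 - \<omega>" and omega_pow6: "\<omega> ^ 6 = 1"
  using omega_sq by algebra+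

lemmas omega_pows = omega_sq omega_pow3 omega_pow4 omega_pow5 omega_pow6

definition lattice_point :: "int \<Rightarrow> int \<Rightarrow> complex" where
  "lattice_point m n = of_int m + of_int n * \<omega>"

definition lattice :: "complex set" where
  "lattice = {lattice_point m n | m n. True}"

definition hex_units :: "complex set" where
  "hex_units = {v. v ^ 6 = 1}"

lemma lattice_point_in [simp]: "lattice_point m n \<in> lattice"
  by (auto simp: lattice_def)

lemma latticeE:
  assumes "z \<in> lattice"
  obtains m n where "z = lattice_point m n"
  using assms by (auto simp: lattice_def)

lemma lattice_point_eq_iff [simp]:
  "lattice_point m n = lattice_point m' n' \<longleftrightarrow> m = m' \<and> n = n'"
  by (auto simp: lattice_point_def complex_eq_iff)

lemma hex_units_eq: "hex_units = {1, \<omega>, \<omega>\<^sup>2, -1, -\<omega>, -(\<omega>\<^sup>2)}"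
proof -
  have "v ^ 6 = 1 \<longleftrightarrow> v\<^sup>2 = 1\<^sup>2 \<or> v\<^sup>2 = \<omega>\<^sup>2 \<or> v\<^sup>2 = (\<omega>\<^sup>2)\<^sup>2" for v
  proof -
    have a: "(\<omega>\<^sup>2)\<^sup>2 = - 1 - \<omega>\<^sup>2"
      using omega_sq by algebra
    \<comment> \<open>A sixth root of unity has a cube root of unity as its square. With
      \<open>a\<close> one primitive cube root, \<open>- 1 - a\<close> is the other.\<close>
    have "x ^ 3 - 1 = (x - 1) * ((x - a) * (x - (- 1 - a)))"
      if "a\<^sup>2 = - 1 - a" for x a :: complex
      using that by (simp add: power2_eq_square power3_eq_cube algebra_simps)
    from this[OF a, of "v\<^sup>2"]
    have "v ^ 6 - 1 = (v\<^sup>2 - 1\<^sup>2) * ((v\<^sup>2 - \<omega>\<^sup>2) * (v\<^sup>2 - (\<omega>\<^sup>2)\<^sup>2))"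
      unfolding a by simp
    moreover have "v ^ 6 = 1 \<longleftrightarrow> v ^ 6 - 1 = 0"
      by simp
    ultimately show ?thesis
      by (simp only: mult_eq_0_iff right_minus_eq)
  qed
  then show ?thesis
    unfolding hex_units_def power2_eq_iff by auto
qed

lemma hex_units_lattice_point:
  "hex_units = {lattice_point 1 0, lattice_point 0 1, lattice_point (-1) 1,
    lattice_point (-1) 0, lattice_point 0 (-1), lattice_point 1 (-1)}"
  by (simp add: hex_units_eq omega_sq lattice_point_def)

lemma lattice_point_double: "2 * lattice_point m n = lattice_point (2 * m) (2 * n)"
  and lattice_point_add: "lattice_point m n + lattice_point m' n' = lattice_point (m + m') (n + n')"
  and lattice_point_diff: "lattice_point m n - lattice_point m' n' = lattice_point (m - m') (n - n')"
  and lattice_point_minus: "- lattice_point m n = lattice_point (- m) (- n)"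
  by (simp_all add: lattice_point_def algebra_simps)

lemmas lattice_point_arith =
  lattice_point_double lattice_point_add lattice_point_diff lattice_point_minus

lemma lattice_add: "x \<in> lattice \<Longrightarrow> y \<in> lattice \<Longrightarrow> x + y \<in> lattice"
  and lattice_diff: "x \<in> lattice \<Longrightarrow> y \<in> lattice \<Longrightarrow> x - y \<in> lattice"
  by (auto elim!: latticeE simp: lattice_point_arith)

lemma lattice_double: "x \<in> lattice \<Longrightarrow> 2 * x \<in> lattice"
  by (auto elim!: latticeE simp: lattice_point_arith)

lemma zero_in_lattice: "0 \<in> lattice"
  by (metis lattice_diff lattice_point_in cancel_comm_monoid_add_class.diff_cancel)

lemma hex_units_subset_lattice: "hex_units \<subseteq> lattice"
  by (auto simp: hex_units_lattice_point)

lemma hex_units_mult: "u \<in> hex_units \<Longrightarrow> v \<in> hex_units \<Longrightarrow> u * v \<in> hex_units"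
  and hex_units_divide: "u \<in> hex_units \<Longrightarrow> v \<in> hex_units \<Longrightarrow> u / v \<in> hex_units"
  and hex_units_minus: "u \<in> hex_units \<Longrightarrow> - u \<in> hex_units"
  and omega_hex_unit: "\<omega> \<in> hex_units"
  and one_hex_unit: "1 \<in> hex_units"
  by (simp_all add: hex_units_def power_mult_distrib power_divide omega_pow6)

lemma hex_units_nonzero: "u \<in> hex_units \<Longrightarrow> u \<noteq> 0"
  by (auto simp: hex_units_def)

lemma norm_hex_unit: "u \<in> hex_units \<Longrightarrow> cmod u = 1"
proof -
  assume "u \<in> hex_units"
  then have "cmod u ^ 6 = 1"
    by (simp add: hex_units_def flip: norm_power)
  then show ?thesis
    by (intro power_eq_imp_eq_base[of _ 6 1]) auto
qed

text \<open>Each unit has an odd coordinate in the basis \<open>1\<close>,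
  \<open>\<omega>\<close>.\<close>

lemma double_not_hex_unit: "x \<in> lattice \<Longrightarrow> 2 * x \<notin> hex_units"
  by (elim latticeE) (auto simp: hex_units_lattice_point lattice_point_arith; presburger)

text \<open>The six units form three pairs \<open>v\<close>, \<open>- v\<close>, one for each
  nonzero residue class of the lattice modulo 2.\<close>

lemma hex_units_cong_mod_2:
  assumes "x \<in> lattice" "v \<in> hex_units" "w \<in> hex_units" "2 * x = w - v"
  shows "w = v \<or> w = - v"
proof -
  obtain m n where x: "x = lattice_point m n"
    using assms(1) by (rule latticeE)
  show ?thesis
    using assms(2-4) unfolding x hex_units_lattice_point
    by (elim insertE emptyE; simp add: lattice_point_arith; presburger)
qed

text \<open>The descent step for covering and for excluding periods: every residue class modulo 2 is
  represented by 0 or a unit, and the coordinate sum serves as the measure.\<close>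

lemma lattice_halve:
  assumes "(m, n) \<noteq> (0, 0)"
  obtains a b v where "v \<in> insert 0 hex_units" "lattice_point m n = 2 * lattice_point a b + v"
    "\<bar>a\<bar> + \<bar>b\<bar> < \<bar>m\<bar> + \<bar>n\<bar>"
proof -
  have 0: "0 = lattice_point 0 0"
    by (simp add: lattice_point_def)
  define p q where "p = m div 2" and "q = n div 2"
  have "m = 2 * p \<or> m = 2 * p + 1" "n = 2 * q \<or> n = 2 * q + 1"
    unfolding p_def q_def by presburger+
  then have "\<exists>a b i j. (i, j) \<in> {(0, 0), (1, 0), (0, 1), (-1, 1), (-1, 0), (0, -1), (1, -1)} \<and>
    m = 2 * a + i \<and> n = 2 * b + j \<and> \<bar>a\<bar> + \<bar>b\<bar> < \<bar>m\<bar> + \<bar>n\<bar>"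
    (is "\<exists>a b i j. ?P a b i j")
  proof (elim disjE)
    assume mn: "m = 2 * p" "n = 2 * q"
    then have "?P p q 0 0"
      using assms by auto
    then show ?thesis by (intro exI)
  next
    assume mn: "m = 2 * p + 1" "n = 2 * q"
    \<comment> \<open>Both signs of the unit are offered, because rounding the odd coordinate
      towards zero depends on its sign.\<close>
    then have "?P p q 1 0 \<or> ?P (p + 1) q (-1) 0"
      by auto
    then show ?thesis by (elim disjE) (intro exI, assumption)+
  next
    assume mn: "m = 2 * p" "n = 2 * q + 1"
    then have "?P p q 0 1 \<or> ?P p (q + 1) 0 (-1)"
      by auto
    then show ?thesis by (elim disjE) (intro exI, assumption)+
  next
    assume mn: "m = 2 * p + 1" "n = 2 * q + 1"
    \<comment> \<open>With both coordinates odd, the units of this class have coordinates of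
      opposite signs, so one coordinate is rounded up and the other down.\<close>
    then have "?P p (q + 1) 1 (-1) \<or> ?P (p + 1) q (-1) 1"
      by auto
    then show ?thesis by (elim disjE) (intro exI, assumption)+
  qed
  then obtain a b i j where
    ij: "(i, j) \<in> {(0, 0), (1, 0), (0, 1), (-1, 1), (-1, 0), (0, -1), (1, -1::int)}"
    and mn: "m = 2 * a + i" "n = 2 * b + j" "\<bar>a\<bar> + \<bar>b\<bar> < \<bar>m\<bar> + \<bar>n\<bar>"
    by (elim exE conjE)
  have "lattice_point i j \<in> insert 0 hex_units"
    using ij unfolding hex_units_lattice_point 0 by auto
  moreover have "lattice_point m n = 2 * lattice_point a b + lattice_point i j"
    by (simp add: mn lattice_point_arith)
  ultimately show thesis
    by (rule that[OF _ _ mn(3)])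
qed

subsection \<open>Arrows and the substitution\<close>

text \<open>Think of each edge of a tile as carrying an arrow: a tile with orientation \<open>u\<close> has outgoing
  arrows in the directions \<open>u\<close>, \<open>\<omega> u\<close>, \<open>- u\<close> and incoming ones in the other three.\<close>

definition exits :: "complex \<Rightarrow> complex \<Rightarrow> bool" where
  "exits u v \<longleftrightarrow> v \<in> {u, \<omega> * u, - u}"

text \<open>With \<open>a = v\<close> or \<open>a = - v\<close> the direction of the arrow, this is \<open>\<omega> ^ 5 * a\<close>.\<close>

definition turn :: "complex \<Rightarrow> complex \<Rightarrow> complex" where
  "turn u v = (if exits u v then - (\<omega>\<^sup>2) * v else \<omega>\<^sup>2 * v)"

definition substitute :: "(complex \<times> complex) set \<Rightarrow> (complex \<times> complex) set" where
  "substitute F = {(2 * z + u * d, u * e) | z u d e. (z, u) \<in> F \<and> (d, e) \<in> recursion_pairs}"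

text \<open>Arrows rotate with the tile, so questions about a direction \<open>w\<close> reduce to
  the fixed units tabulated in \<open>exits_base\<close>.\<close>

lemma exits_scale: "x \<noteq> 0 \<Longrightarrow> exits (a * x) (b * x) \<longleftrightarrow> exits a b"
proof -
  assume x: "x \<noteq> 0"
  have "b * x = (\<omega> * a) * x \<longleftrightarrow> b = \<omega> * a" "b * x = (- a) * x \<longleftrightarrow> b = - a"
    using x mult_cancel_right by blast+
  then show ?thesis
    using x by (simp add: exits_def mult.assoc)
qed

lemma exits_base:
  "exits (\<omega>\<^sup>2) (-1)" "\<not> exits (- (\<omega>\<^sup>2)) (-1)" "exits (- (\<omega>\<^sup>2)) 1" "\<not> exits (\<omega>\<^sup>2) 1"
  "exits 1 1" "exits 1 \<omega>" "\<not> exits 1 (\<omega>\<^sup>2)" "exits 1 (-1)" "\<not> exits 1 (- \<omega>)" "\<not> exits 1 (- (\<omega>\<^sup>2))"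
  "exits (\<omega>\<^sup>2) (\<omega>\<^sup>2)" "exits (\<omega>\<^sup>2) (- (\<omega>\<^sup>2))" "exits (- (\<omega>\<^sup>2)) (\<omega>\<^sup>2)" "exits (- (\<omega>\<^sup>2)) (- (\<omega>\<^sup>2))"
  "\<not> exits (\<omega>\<^sup>2) \<omega>" "\<not> exits (\<omega>\<^sup>2) (- \<omega>)" "\<not> exits (- (\<omega>\<^sup>2)) \<omega>" "\<not> exits (- (\<omega>\<^sup>2)) (- \<omega>)"
  by (auto simp: exits_def omega_sq complex_eq_iff algebra_simps)

text \<open>The midpoint tile in direction \<open>w\<close> from a doubled centre looks back along
  \<open>- w\<close>; its arrow there agrees with that of the tile kept at the doubled
  centre.\<close>

lemma exits_turn_back:
  assumes "w \<noteq> 0"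
  shows "exits (turn u w) (- w) \<longleftrightarrow> \<not> exits u w"
proof -
  have "exits (a * w) (- w) \<longleftrightarrow> exits a (-1)" for a
    using exits_scale[OF assms, of a "-1"] by simp
  then show ?thesis
    by (cases "exits u w") (simp_all only: turn_def if_True if_False exits_base simp_thms)
qed

text \<open>The midpoint tile passes the arrow on: the doubled edge is cut into two edges with the
  same direction of arrow.\<close>

lemma exits_turn_forward:
  assumes "w \<noteq> 0"
  shows "exits (turn u w) w \<longleftrightarrow> exits u w"
proof -
  have "exits (a * w) w \<longleftrightarrow> exits a 1" for a
    using exits_scale[OF assms, of a 1] by simp
  then show ?thesis
    by (cases "exits u w") (simp_all only: turn_def if_True if_False exits_base simp_thms)
qed

text \<open>Off the line of the doubled edge the arrows of a midpoint tile do not depend on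
  \<open>u\<close>. This makes neighbouring midpoint tiles agree.\<close>

lemma exits_turn_side:
  assumes "v \<noteq> 0"
  shows "exits (turn u v) (\<omega>\<^sup>2 * v)" "exits (turn u v) (- (\<omega>\<^sup>2 * v))"
    "\<not> exits (turn u v) (\<omega> * v)" "\<not> exits (turn u v) (- (\<omega> * v))"
  unfolding mult_minus_left[symmetric]
  by (simp_all only: turn_def exits_scale[OF assms] exits_base simp_thms split: if_split)

text \<open>This is where the numbers of the recursion enter: the six outer rotations are exactly
  those that \<open>turn\<close> prescribes around a tile of orientation 1.\<close>

lemma recursion_pairs_eq: "recursion_pairs = insert (0, 1) ((\<lambda>d. (d, turn 1 d)) ` hex_units)"
proof -
  have eqs: "- (\<omega>\<^sup>2) * 1 = \<omega> ^ 5" "- (\<omega>\<^sup>2) * \<omega> = 1" "\<omega>\<^sup>2 * \<omega>\<^sup>2 = \<omega> ^ 4"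
    "- (\<omega>\<^sup>2) * (- 1) = \<omega>\<^sup>2" "\<omega>\<^sup>2 * (- \<omega>) = 1" "\<omega>\<^sup>2 * (- (\<omega>\<^sup>2)) = \<omega>"
    by (simp_all add: omega_pows omega_mult algebra_simps)
  have "turn 1 1 = \<omega> ^ 5" "turn 1 \<omega> = 1" "turn 1 (\<omega>\<^sup>2) = \<omega> ^ 4"
    "turn 1 (-1) = \<omega>\<^sup>2" "turn 1 (- \<omega>) = 1" "turn 1 (- (\<omega>\<^sup>2)) = \<omega>"
    by (simp_all only: turn_def exits_base if_True if_False simp_thms eqs)
  moreover have "- \<omega> = \<omega> ^ 4" "- (\<omega>\<^sup>2) = \<omega> ^ 5" "-1 = \<omega> ^ 3"
    by (simp_all add: omega_pows)
  ultimately show ?thesis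
    unfolding recursion_pairs_def hex_units_eq by auto
qed

lemma turn_mult: "u \<noteq> 0 \<Longrightarrow> u * turn 1 d = turn u (u * d)"
  using exits_scale[of u 1 d] by (simp add: turn_def mult.commute mult.left_commute)

lemma substituteI:
  "(z, u) \<in> F \<Longrightarrow> (d, e) \<in> recursion_pairs \<Longrightarrow> (2 * z + u * d, u * e) \<in> substitute F"
  unfolding substitute_def by blast

text \<open>Putting \<open>v = u * d\<close> removes the rotation of the seven-tile patch: the new
  orientation depends on \<open>u\<close> only through the arrow along \<open>v\<close>.\<close>

lemma substitute_eq:
  assumes "F \<subseteq> lattice \<times> hex_units"
  shows "substitute F = {(2 * z, u) | z u. (z, u) \<in> F} \<union>
    {(2 * z + v, turn u v) | z u v. (z, u) \<in> F \<and> v \<in> hex_units}" (is "_ = ?A \<union> ?B")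
proof
  show "substitute F \<subseteq> ?A \<union> ?B"
  proof
    fix p assume "p \<in> substitute F"
    then obtain z u d e where F: "(z, u) \<in> F" and de: "(d, e) \<in> recursion_pairs"
      and p: "p = (2 * z + u * d, u * e)"
      unfolding substitute_def by blast
    have u: "u \<in> hex_units"
      using F assms by auto
    from de consider "d = 0" "e = 1" | "d \<in> hex_units" "e = turn 1 d"
      unfolding recursion_pairs_eq by auto
    then show "p \<in> ?A \<union> ?B"
    proof cases
      case 1
      then show ?thesis using F p by auto
    next
      case 2
      then have "p = (2 * z + u * d, turn u (u * d))" "u * d \<in> hex_units"
        using p u turn_mult hex_units_nonzero hex_units_mult by auto
      then show ?thesis using F by blast
    qed
  qed
next
  have "(2 * z, u) \<in> substitute F" if "(z, u) \<in> F" for z u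
    using substituteI[OF that, of 0 1] by (simp add: recursion_pairs_eq)
  then have "?A \<subseteq> substitute F"
    by blast
  moreover have "(2 * z + v, turn u v) \<in> substitute F" if "(z, u) \<in> F" "v \<in> hex_units" for z u v
  proof -
    have u: "u \<in> hex_units"
      using that assms by auto
    then have "u * (v / u) = v" "u * turn 1 (v / u) = turn u v"
      using hex_units_nonzero[OF u] turn_mult[of u "v / u"] by auto
    moreover have "(v / u, turn 1 (v / u)) \<in> recursion_pairs"
      using u that hex_units_divide by (auto simp: recursion_pairs_eq)
    ultimately show ?thesis
      using that substituteI by metis
  qed
  ultimately show "?A \<union> ?B \<subseteq> substitute F"
    by blast
qed

section \<open>Matching of arrows and its preservation under the substitution\<close>

definition match :: "complex \<times> complex \<Rightarrow> complex \<times> complex \<Rightarrow> bool" where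
  "match p q \<longleftrightarrow> (fst p = fst q \<longrightarrow> snd p = snd q) \<and>
     (\<forall>w\<in>hex_units. fst q = fst p + w \<longrightarrow> (exits (snd p) w \<longleftrightarrow> \<not> exits (snd q) (- w)))"

text \<open>Agreement at equal centres is the goal. Agreement of adjacent tiles makes it inductive,
  since both of them produce a tile at their common midpoint.\<close>

definition matched :: "(complex \<times> complex) set \<Rightarrow> bool" where
  "matched F \<longleftrightarrow> (\<forall>p\<in>F. \<forall>q\<in>F. match p q)"

lemma match_sym:
  assumes "match p q"
  shows "match q p"
  unfolding match_def
proof (intro conjI impI ballI)
  assume "fst q = fst p"
  then show "snd q = snd p"
    using assms by (simp add: match_def)
next
  fix w assume w: "w \<in> hex_units" "fst p = fst q + w"
  then have "- w \<in> hex_units" "fst q = fst p + - w"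
    using hex_units_minus by auto
  then have "exits (snd p) (- w) \<longleftrightarrow> \<not> exits (snd q) (- (- w))"
    using assms unfolding match_def by blast
  then show "exits (snd q) w \<longleftrightarrow> \<not> exits (snd p) (- w)"
    by auto
qed

lemma turn_hex_unit: "v \<in> hex_units \<Longrightarrow> turn u v \<in> hex_units"
  unfolding turn_def
  using hex_units_mult hex_units_minus omega_hex_unit by (simp add: power2_eq_square)

lemma substitute_subset:
  assumes "F \<subseteq> lattice \<times> hex_units"
  shows "substitute F \<subseteq> lattice \<times> hex_units"
  unfolding substitute_eq[OF assms]
  using assms hex_units_subset_lattice
  by (auto intro!: lattice_add lattice_double turn_hex_unit)

lemma match_even_odd:
  assumes m: "match (z, u) (z', u')" and L: "z \<in> lattice" "z' \<in> lattice" and v: "v \<in> hex_units"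
  shows "match (2 * z, u) (2 * z' + v, turn u' v)"
  unfolding match_def fst_conv snd_conv
proof (intro conjI impI ballI)
  assume "2 * z = 2 * z' + v"
  then have "v = 2 * (z - z')"
    by (simp add: algebra_simps)
  then show "u = turn u' v"
    using v double_not_hex_unit lattice_diff[OF L] by blast
next
  fix w assume w: "w \<in> hex_units" and eq: "2 * z' + v = 2 * z + w"
  have "2 * (z' - z) = w - v"
    using eq by (simp add: algebra_simps)
  then have "w = v \<or> w = - v"
    using hex_units_cong_mod_2 lattice_diff L v w by blast
  then show "exits u w \<longleftrightarrow> \<not> exits (turn u' v) (- w)"
  proof
    \<comment> \<open>The kept tile and the midpoint tile come from the same centre
      \<open>z = z'\<close>, but the midpoint would lie at \<open>2 * z + v\<close> as seen from
      either.\<close>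
    assume [simp]: "w = v"
    then have "u = u'"
      using m eq by (simp add: match_def)
    then show ?thesis
      using exits_turn_back hex_units_nonzero[OF v] by simp
  next
    \<comment> \<open>Here the midpoint tile comes from the adjacent centre
      \<open>z' = z + w\<close> and sits on the doubled edge towards \<open>z\<close>.\<close>
    assume wv: "w = - v"
    then have "2 * z' = 2 * (z + w)"
      using eq by (simp add: algebra_simps)
    then have "z' = z + w"
      unfolding mult_cancel_left by simp
    then have "exits u w \<longleftrightarrow> \<not> exits u' (- w)"
      using m w by (simp add: match_def)
    then show ?thesis
      using exits_turn_forward hex_units_nonzero[OF v] wv by simp
  qed
qed

lemma match_odd_odd:
  assumes m: "match (z, u) (z', u')" and L: "z \<in> lattice" "z' \<in> lattice"
    and v: "v \<in> hex_units" "v' \<in> hex_units"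
  shows "match (2 * z + v, turn u v) (2 * z' + v', turn u' v')"
  unfolding match_def fst_conv snd_conv
proof (intro conjI impI ballI)
  assume eq: "2 * z + v = 2 * z' + v'"
  then have "2 * (z - z') = v' - v"
    by (simp add: algebra_simps)
  then have "v' = v \<or> v' = - v"
    using hex_units_cong_mod_2 lattice_diff L v by blast
  then show "turn u v = turn u' v'"
  proof
    assume "v' = v"
    then show ?thesis
      using m eq by (simp add: match_def)
  next
    \<comment> \<open>The two parents are adjacent and produce the same midpoint from opposite ends;
      the matching arrow between them makes the results equal.\<close>
    assume v': "v' = - v"
    then have "2 * z' = 2 * (z + v)"
      using eq by (simp add: algebra_simps)
    then have "z' = z + v"
      unfolding mult_cancel_left by simp
    then have "exits u v \<longleftrightarrow> \<not> exits u' (- v)"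
      using m v by (simp add: match_def)
    then show ?thesis
      by (simp add: turn_def v')
  qed
next
  fix w assume w: "w \<in> hex_units" and eq: "2 * z' + v' = 2 * z + v + w"
  define y where "y = z' - z"
  have y: "y \<in> lattice"
    using L lattice_diff by (simp add: y_def)
  have eq': "v' + 2 * y = v + w"
    using eq by (simp add: y_def algebra_simps)
  \<comment> \<open>Modulo 2 this reads \<open>v' = v + w\<close>, so adjacent midpoints have
    \<open>v\<close>, \<open>w\<close>, \<open>v'\<close> in three different classes; the first two
    cases below fail by parity.\<close>
  then have v'_eq: "v' = v + w - 2 * y"
    by (simp add: eq_diff_eq)
  have v0: "v \<noteq> 0" "v' \<noteq> 0"
    using v hex_units_nonzero by auto
  have vL: "v \<in> lattice"
    using v hex_units_subset_lattice by blast
  have "w / v \<in> hex_units"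
    using v w hex_units_divide by blast
  then have "w = v \<or> w = - v \<or> (w = \<omega> * v \<or> w = - (\<omega> * v)) \<or> (w = \<omega>\<^sup>2 * v \<or> w = - (\<omega>\<^sup>2 * v))"
    using v0 by (auto simp: hex_units_eq field_simps)
  then consider "w = v" | "w = - v" | "w = \<omega> * v \<or> w = - (\<omega> * v)" | "w = \<omega>\<^sup>2 * v \<or> w = - (\<omega>\<^sup>2 * v)"
    by blast
  then show "exits (turn u v) w \<longleftrightarrow> \<not> exits (turn u' v') (- w)"
  proof cases
    case 1
    then have "v' = 2 * (v - y)"
      using eq' by (simp add: algebra_simps)
    then show ?thesis
      using double_not_hex_unit[OF lattice_diff[OF vL y]] v by metis
  next
    case 2
    then have "v' = 2 * (0 - y)"
      using eq' by (simp add: eq_neg_iff_add_eq_0 add.commute)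
    then show ?thesis
      using double_not_hex_unit[OF lattice_diff[OF zero_in_lattice y]] v by metis
  next
    case 3
    have oL: "\<omega>\<^sup>2 * v \<in> hex_units"
      using hex_units_mult omega_hex_unit v by (simp add: power2_eq_square)
    \<comment> \<open>Since \<open>1 + \<omega>\<close> is congruent to
      \<open>\<omega>\<^sup>2\<close> modulo 2, \<open>v'\<close> lies in the class of
      \<open>\<omega>\<^sup>2 * v\<close>. Thus the shared edge is an incoming side of the first
      tile and an outgoing side of the second.\<close>
    have "2 * (v - y) = v' - \<omega>\<^sup>2 * v \<or> 2 * (v - \<omega> * v - y) = v' - \<omega>\<^sup>2 * v"
      using 3 by (elim disjE) (simp_all add: v'_eq omega_sq algebra_simps)
    moreover have "v - y \<in> lattice" "v - \<omega> * v - y \<in> lattice"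
      using y vL hex_units_mult[OF omega_hex_unit v(1)] hex_units_subset_lattice
      by (auto intro!: lattice_diff)
    ultimately have "v' = \<omega>\<^sup>2 * v \<or> v' = - (\<omega>\<^sup>2 * v)"
      using hex_units_cong_mod_2 oL v by metis
    moreover have "\<omega>\<^sup>2 * (\<omega>\<^sup>2 * v) = - (\<omega> * v)"
      using omega_pow4 by (simp flip: mult.assoc power_add)
    ultimately have w': "w = \<omega>\<^sup>2 * v' \<or> w = - (\<omega>\<^sup>2 * v')"
      using 3 by auto
    have "\<not> exits (turn u v) w"
      using 3 exits_turn_side[OF v0(1)] by (elim disjE) simp_all
    moreover have "exits (turn u' v') (- w)"
      using w' exits_turn_side[OF v0(2)] by (elim disjE) simp_all
    ultimately show ?thesis
      by blast
  next
    case 4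
    have oL: "\<omega> * v \<in> hex_units"
      using hex_units_mult omega_hex_unit v by simp
    \<comment> \<open>The mirror situation: \<open>v'\<close> is in the class of
      \<open>\<omega> * v\<close>, and the first tile now has the outgoing side.\<close>
    have "2 * (0 - y) = v' - \<omega> * v \<or> 2 * (v - \<omega> * v - y) = v' - \<omega> * v"
      using 4 by (elim disjE) (simp_all add: v'_eq omega_sq algebra_simps)
    moreover have "0 - y \<in> lattice" "v - \<omega> * v - y \<in> lattice"
      using y vL oL hex_units_subset_lattice zero_in_lattice by (blast intro: lattice_diff)+
    ultimately have "v' = \<omega> * v \<or> v' = - (\<omega> * v)"
      using hex_units_cong_mod_2 oL v by metis
    then have w': "w = \<omega> * v' \<or> w = - (\<omega> * v')"
      using 4 by (auto simp: power2_eq_square mult.assoc)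
    have "exits (turn u v) w"
      using 4 exits_turn_side[OF v0(1)] by (elim disjE) simp_all
    moreover have "\<not> exits (turn u' v') (- w)"
      using w' exits_turn_side[OF v0(2)] by (elim disjE) simp_all
    ultimately show ?thesis
      by blast
  qed
qed

text \<open>New centres are doubled centres or midpoints, which gives the cases; two doubled centres
  are never adjacent, by parity.\<close>

lemma matched_substitute:
  assumes F: "F \<subseteq> lattice \<times> hex_units" and "matched F"
  shows "matched (substitute F)"
proof -
  have m: "match (z, u) (z', u')" if "(z, u) \<in> F" "(z', u') \<in> F" for z u z' u'
    using that assms by (auto simp: matched_def)
  have L: "z \<in> lattice" "u \<in> hex_units" if "(z, u) \<in> F" for z u
    using that F by auto
  have even: "match (2 * z, u) (2 * z', u')" if "(z, u) \<in> F" "(z', u') \<in> F" for z u z' u'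
    unfolding match_def fst_conv snd_conv
  proof (intro conjI impI ballI)
    assume "2 * z = 2 * z'"
    then show "u = u'" using m[OF that] by (simp add: match_def)
  next
    fix w assume "w \<in> hex_units" "2 * z' = 2 * z + w"
    moreover from this have "w = 2 * (z' - z)"
      by (simp add: algebra_simps)
    ultimately show "exits u w \<longleftrightarrow> \<not> exits u' (- w)"
      using double_not_hex_unit lattice_diff L(1) that by metis
  qed
  have eo: "match (2 * z, u) (2 * z' + v, turn u' v)"
    if "(z, u) \<in> F" "(z', u') \<in> F" "v \<in> hex_units" for z u z' u' v
    using match_even_odd m L that by metis
  have oo: "match (2 * z + v, turn u v) (2 * z' + v', turn u' v')"
    if "(z, u) \<in> F" "(z', u') \<in> F" "v \<in> hex_units" "v' \<in> hex_units" for z u z' u' v v'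
    using match_odd_odd m L that by metis
  show ?thesis
    unfolding matched_def substitute_eq[OF F]
  proof (intro ballI, elim UnE CollectE exE conjE, goal_cases)
    case 1 then show ?case by (simp only: even)
  next
    case 2 then show ?case by (simp only: eo)
  next
    case 3 then show ?case by (simp only: match_sym[OF eo])
  next
    case 4 then show ?case by (simp only: oo)
  qed
qed

section \<open>The patches of the recursion as iterated substitutions\<close>

definition expand :: "nat \<Rightarrow> (complex \<times> complex) set \<Rightarrow> (complex \<times> complex) set" where
  "expand n F = {(2 ^ n * d + e * z, e * u) | z u d e. (z, u) \<in> F \<and> (d, e) \<in> recursion_pairs}"

text \<open>Pairs of centre and orientation replace marked hexagons, so that comparing tiles becomes
  comparing numbers; \<open>P_eq\<close> translates back.\<close>

primrec tiles_upto :: "nat \<Rightarrow> (complex \<times> complex) set" where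
  "tiles_upto 0 = {(0, 1)}"
| "tiles_upto (Suc n) = expand n (tiles_upto n)"

definition tile :: "complex set \<Rightarrow> complex \<times> complex \<Rightarrow> marked_hexagon" where
  "tile c p = place (fst p) (snd p) (H, c)"

lemma place_place: "place a u (place b v T) = place (a + u * b) (u * v) T"
  by (simp add: place_def image_image algebra_simps)

lemma P_eq: "P c n = tile c ` tiles_upto n"
proof (induction n)
  case 0
  then show ?case by (simp add: tile_def place_def)
next
  case (Suc n)
  have *: "tile c (2 ^ n * d + e * z, e * u) = place (2 ^ n * d) e (tile c (z, u))" for d e z u
    by (simp add: tile_def place_place)
  have "tile c ` expand n F = (\<Union>(d, u)\<in>recursion_pairs. place (2 ^ n * d) u ` tile c ` F)" for F
  proof (intro set_eqI iffI)
    fix T assume "T \<in> tile c ` expand n F"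
    then obtain z u d e where "(z, u) \<in> F" "(d, e) \<in> recursion_pairs"
      "T = place (2 ^ n * d) e (tile c (z, u))"
      unfolding expand_def using * by blast
    then show "T \<in> (\<Union>(d, u)\<in>recursion_pairs. place (2 ^ n * d) u ` tile c ` F)"
      by blast
  next
    fix T assume "T \<in> (\<Union>(d, u)\<in>recursion_pairs. place (2 ^ n * d) u ` tile c ` F)"
    then obtain z u d e where "(z, u) \<in> F" "(d, e) \<in> recursion_pairs"
      "T = place (2 ^ n * d) e (tile c (z, u))"
      by auto
    then have "T = tile c (2 ^ n * d + e * z, e * u)"
      "(2 ^ n * d + e * z, e * u) \<in> expand n F"
      unfolding expand_def using * by auto
    then show "T \<in> tile c ` expand n F"
      by (rule image_eqI)
  qed
  then show ?case
    using Suc by simp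
qed

text \<open>The substitution commutes with rotations and doubles displacements, so substituting
  inside seven placed copies is placing seven substituted copies twice as far out.\<close>

lemma substitute_expand: "substitute (expand n F) = expand (Suc n) (substitute F)"
proof (intro set_eqI iffI)
  fix p assume "p \<in> substitute (expand n F)"
  then obtain z u d e d' e' where "(z, u) \<in> F" "(d, e) \<in> recursion_pairs" "(d', e') \<in> recursion_pairs"
    and p: "p = (2 * (2 ^ n * d + e * z) + e * u * d', e * u * e')"
    by (auto simp: substitute_def expand_def)
  moreover have "p = (2 ^ Suc n * d + e * (2 * z + u * d'), e * (u * e'))"
    by (simp add: p algebra_simps)
  ultimately show "p \<in> expand (Suc n) (substitute F)"
    unfolding substitute_def expand_def by blast
next
  fix p assume "p \<in> expand (Suc n) (substitute F)"
  then obtain z u d e d' e' where "(z, u) \<in> F" "(d, e) \<in> recursion_pairs" "(d', e') \<in> recursion_pairs"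
    and p: "p = (2 ^ Suc n * d + e * (2 * z + u * d'), e * (u * e'))"
    unfolding substitute_def expand_def by blast
  moreover have "p = (2 * (2 ^ n * d + e * z) + (e * u) * d', (e * u) * e')"
    by (simp add: p algebra_simps)
  ultimately show "p \<in> substitute (expand n F)"
    unfolding substitute_def expand_def by blast
qed

text \<open>The recursion places copies of the whole patch; equivalently, every single tile is replaced by
  seven tiles, which is the form that propagates local rules.\<close>

lemma tiles_upto_Suc: "tiles_upto (Suc n) = substitute (tiles_upto n)"
proof (induction n)
  case 0
  then show ?case by (auto simp: substitute_def expand_def)
next
  case (Suc n)
  have "tiles_upto (Suc (Suc n)) = expand (Suc n) (substitute (tiles_upto n))"
    using Suc by (simp only: tiles_upto.simps)
  also have "\<dots> = substitute (tiles_upto (Suc n))"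
    by (simp only: substitute_expand tiles_upto.simps)
  finally show ?case .
qed

lemma tiles_upto_subset: "tiles_upto n \<subseteq> lattice \<times> hex_units"
proof (induction n)
  case 0
  then show ?case by (simp add: zero_in_lattice one_hex_unit)
next
  case (Suc n)
  then show ?case unfolding tiles_upto_Suc by (rule substitute_subset)
qed

lemma matched_tiles_upto: "matched (tiles_upto n)"
proof (induction n)
  case 0
  then show ?case by (auto simp: matched_def match_def dest: hex_units_nonzero)
next
  case (Suc n)
  then show ?case unfolding tiles_upto_Suc using matched_substitute tiles_upto_subset by blast
qed

lemma mono_tiles_upto: "mono tiles_upto"
proof (rule mono_iff_le_Suc[THEN iffD2], intro allI)
  fix n
  have "(0, 1) \<in> recursion_pairs"
    by (simp add: recursion_pairs_def)
  then show "tiles_upto n \<le> tiles_upto (Suc n)"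
    by (force simp: expand_def)
qed

section \<open>The limit of the patches\<close>

definition tiles :: "(complex \<times> complex) set" where
  "tiles = (\<Union>n. tiles_upto n)"

lemma P_inf_eq: "P_inf c = tile c ` tiles"
  by (simp add: P_inf_def P_eq tiles_def image_UN)

lemma tiles_subset: "tiles \<subseteq> lattice \<times> hex_units"
  using tiles_upto_subset by (auto simp: tiles_def)

text \<open>The patches increase, so two tiles always lie in a common patch, which is
  matched.\<close>

lemma tiles_unique:
  assumes "(z, u) \<in> tiles" "(z, u') \<in> tiles"
  shows "u = u'"
proof -
  obtain m n where "(z, u) \<in> tiles_upto m" "(z, u') \<in> tiles_upto n"
    using assms by (auto simp: tiles_def)
  then have "(z, u) \<in> tiles_upto (max m n)" "(z, u') \<in> tiles_upto (max m n)"
    using monoD[OF mono_tiles_upto] by (meson max.cobounded1 max.cobounded2 subsetD)+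
  then have "match (z, u) (z, u')"
    using matched_tiles_upto unfolding matched_def by blast
  then show ?thesis
    by (simp add: match_def)
qed

lemma origin_in_tiles: "(0, 1) \<in> tiles"
  unfolding tiles_def by (rule UN_I[of 0]) auto

lemma tiles_double: "(z, u) \<in> tiles \<Longrightarrow> (2 * z, u) \<in> tiles"
  and tiles_turn: "(z, u) \<in> tiles \<Longrightarrow> v \<in> hex_units \<Longrightarrow> (2 * z + v, turn u v) \<in> tiles"
proof -
  assume "(z, u) \<in> tiles"
  then obtain n where n: "(z, u) \<in> tiles_upto n"
    by (auto simp: tiles_def)
  have "(2 * z, u) \<in> tiles_upto (Suc n)"
    and v: "v \<in> hex_units \<Longrightarrow> (2 * z + v, turn u v) \<in> tiles_upto (Suc n)"
    using n unfolding tiles_upto_Suc substitute_eq[OF tiles_upto_subset] by auto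
  then show "(2 * z, u) \<in> tiles" "v \<in> hex_units \<Longrightarrow> (2 * z + v, turn u v) \<in> tiles"
    unfolding tiles_def by blast+
qed

lemma tiles_cover_lattice_point: "\<exists>u. (lattice_point m n, u) \<in> tiles"
proof (induction "nat (\<bar>m\<bar> + \<bar>n\<bar>)" arbitrary: m n rule: less_induct)
  case less
  show ?case
  proof (cases "(m, n) = (0, 0)")
    case True
    then show ?thesis
      using origin_in_tiles by (auto simp: lattice_point_def)
  next
    case False
    then obtain a b v where ab: "v \<in> insert 0 hex_units" "lattice_point m n = 2 * lattice_point a b + v"
      "\<bar>a\<bar> + \<bar>b\<bar> < \<bar>m\<bar> + \<bar>n\<bar>"
      by (rule lattice_halve)
    have "nat (\<bar>a\<bar> + \<bar>b\<bar>) < nat (\<bar>m\<bar> + \<bar>n\<bar>)"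
      using ab(3) by linarith
    from less[OF this] obtain u where "(lattice_point a b, u) \<in> tiles"
      by blast
    then show ?thesis
      using ab(1,2) tiles_double tiles_turn by fastforce
  qed
qed

lemma tiles_cover: "z \<in> lattice \<Longrightarrow> \<exists>u. (z, u) \<in> tiles"
  by (auto simp: tiles_cover_lattice_point elim: latticeE)

section \<open>Absence of periods\<close>

lemma no_period_point:
  assumes "\<And>z u. (z, u) \<in> tiles \<Longrightarrow> (z + lattice_point m n, u) \<in> tiles"
  shows "(m, n) = (0, 0)"
  using assms
proof (induction "nat (\<bar>m\<bar> + \<bar>n\<bar>)" arbitrary: m n rule: less_induct)
  case less
  show ?case
  proof (rule ccontr)
    assume mn: "(m, n) \<noteq> (0, 0)"
    then obtain a b v where v: "v \<in> insert 0 hex_units"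
      and eq: "lattice_point m n = 2 * lattice_point a b + v"
      and ab: "\<bar>a\<bar> + \<bar>b\<bar> < \<bar>m\<bar> + \<bar>n\<bar>"
      by (rule lattice_halve)
    define s where "s = lattice_point a b"
    have cover: "\<exists>u'. (z + s, u') \<in> tiles" if "(z, u) \<in> tiles" for z u
      using that tiles_subset by (intro tiles_cover lattice_add) (auto simp: s_def)
    have shift: "(2 * (z + s) + v, u) \<in> tiles" if "(z, u) \<in> tiles" for z u
      using less.prems[OF tiles_double[OF that]] by (simp add: eq s_def algebra_simps)
    show False
    proof (cases "v = 0")
      case True
      \<comment> \<open>Some tile sits at \<open>z + s\<close>; doubling it gives a tile at the
        point where the period puts orientation \<open>u\<close>, so uniqueness transfers
        \<open>u\<close> to \<open>z + s\<close>, and half the period is a period.\<close>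
      have "(z + s, u) \<in> tiles" if zu: "(z, u) \<in> tiles" for z u
        using cover[OF zu] shift[OF zu] tiles_double tiles_unique True by (metis add.right_neutral)
      then have "(a, b) = (0, 0)"
        unfolding s_def by (intro less.hyps) (use ab in linarith)
      then show False
        using eq True mn by (simp add: lattice_point_double)
    next
      case False
      then have v: "v \<in> hex_units"
        using v by simp
      \<comment> \<open>The period moves every doubled centre to a midpoint of direction
        \<open>v\<close>, whose orientation is \<open>\<omega>\<^sup>2 * v\<close> up to sign.
        Squaring removes the sign; the tiles at 0 and 1 then contradict each other.\<close>
      have sq: "u\<^sup>2 = \<omega> ^ 4 * v\<^sup>2" if zu: "(z, u) \<in> tiles" for z u
      proof -
        obtain u' where "(z + s, u') \<in> tiles"
          using cover[OF zu] by blast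
        then have "u = turn u' v"
          using tiles_turn[OF _ v] shift[OF zu] tiles_unique by blast
        then show ?thesis
          by (auto simp: turn_def power_mult_distrib)
      qed
      have "(2 * 0 + 1, turn 1 1) \<in> tiles"
        using tiles_turn origin_in_tiles one_hex_unit by blast
      then have "(turn 1 1)\<^sup>2 = (1::complex)\<^sup>2"
        using sq origin_in_tiles by metis
      then show False
        by (simp add: turn_def exits_base omega_pow4 complex_eq_iff)
    qed
  qed
qed

lemma no_period:
  assumes "\<And>z u. (z, u) \<in> tiles \<Longrightarrow> (z + t, u) \<in> tiles"
  shows "t = 0"
proof -
  have "(0 + t, 1) \<in> tiles"
    using assms origin_in_tiles by blast
  then have "t \<in> lattice"
    using tiles_subset by auto
  then obtain m n where t: "t = lattice_point m n"
    by (rule latticeE)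
  then have "(m, n) = (0, 0)"
    using no_period_point assms by blast
  then show ?thesis
    by (simp add: t lattice_point_def)
qed

subsection \<open>The hexagon\<close>

lemma exp_pi_third_power: "exp (\<i> * of_real (real k * pi / 3)) = \<omega> ^ k"
  unfolding \<omega>_def by (simp flip: exp_of_nat_mult add: algebra_simps)

text \<open>\<open>(1 + \<omega>) / 3\<close> is the centroid of the triangle \<open>0\<close>,
  \<open>1\<close>, \<open>\<omega>\<close>, where three hexagons meet.\<close>

lemma hex_vertex_eq: "hex_vertex (pi / 6 + real k * pi / 3) = \<omega> ^ k * ((1 + \<omega>) / 3)"
proof -
  have 1: "of_real (1 / sqrt 3) * exp (\<i> * of_real (pi / 6)) = (1 + \<omega>) / 3"
    by (simp add: complex_eq_iff Re_exp Im_exp cos_30 sin_30 real_div_sqrt field_simps)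
  have 2: "exp (\<i> * of_real (pi / 6 + real k * pi / 3)) =
      exp (\<i> * of_real (pi / 6)) * exp (\<i> * of_real (real k * pi / 3))"
    by (simp add: algebra_simps flip: exp_add)
  have "hex_vertex (pi / 6 + real k * pi / 3) =
      of_real (1 / sqrt 3) * (exp (\<i> * of_real (pi / 6)) * \<omega> ^ k)"
    by (simp only: hex_vertex_def 2 exp_pi_third_power)
  also have "\<dots> = \<omega> ^ k * (of_real (1 / sqrt 3) * exp (\<i> * of_real (pi / 6)))"
    by (simp only: mult_ac)
  finally show ?thesis
    by (simp only: 1)
qed

lemma hex_units_powers: "hex_units = {\<omega> ^ k | k. k \<le> (5::nat)}"
proof -
  have "{\<omega> ^ k | k. k \<le> (5::nat)} = (\<lambda>k. \<omega> ^ k) ` {..5}"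
    by auto
  also have "{..5::nat} = {0, 1, 2, 3, 4, 5}"
    by auto
  also have "(\<lambda>k. \<omega> ^ k) ` {0, 1, 2, 3, 4, 5::nat} = hex_units"
    by (auto simp: hex_units_eq omega_pows)
  finally show ?thesis ..
qed

lemma H_eq: "H = convex hull ((\<lambda>u. u * ((1 + \<omega>) / 3)) ` hex_units)"
proof -
  have "{hex_vertex (pi / 6 + real k * pi / 3) | k. k \<le> (5::nat)} =
      (\<lambda>u. u * ((1 + \<omega>) / 3)) ` hex_units"
    unfolding hex_units_powers hex_vertex_eq by auto
  then show ?thesis
    by (simp add: H_def)
qed

lemma finite_hex_units: "finite hex_units"
  by (simp add: hex_units_eq)

lemma compact_H: "compact H"
  unfolding H_eq by (intro finite_imp_compact_convex_hull finite_imageI finite_hex_units)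

lemma convex_H: "convex H"
  by (simp add: H_def)

lemma hex_unit_mult_H_subset:
  assumes u: "u \<in> hex_units"
  shows "(\<lambda>z. u * z) ` H \<subseteq> H"
proof -
  have "linear ((*) u)"
    by (simp add: linear_times)
  then have "(*) u ` H = convex hull ((*) u ` (\<lambda>u. u * ((1 + \<omega>) / 3)) ` hex_units)"
    unfolding H_eq by (rule convex_hull_linear_image)
  also have "\<dots> \<subseteq> H"
    unfolding H_eq
  proof (rule hull_mono, safe)
    fix v assume "v \<in> hex_units"
    then have "u * v \<in> hex_units"
      using u hex_units_mult by blast
    moreover have "u * (v * ((1 + \<omega>) / 3)) = (u * v) * ((1 + \<omega>) / 3)"
      by simp
    ultimately show "u * (v * ((1 + \<omega>) / 3)) \<in> (\<lambda>u. u * ((1 + \<omega>) / 3)) ` hex_units"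
      by (rule image_eqI[rotated])
  qed
  finally show ?thesis .
qed

lemma hex_unit_mult_in_H: "u \<in> hex_units \<Longrightarrow> z \<in> H \<Longrightarrow> u * z \<in> H"
  using hex_unit_mult_H_subset by blast

lemma hex_unit_image_H:
  assumes u: "u \<in> hex_units"
  shows "(\<lambda>z. a + u * z) ` H = (\<lambda>z. a + z) ` H"
proof (intro equalityI subsetI)
  fix p assume "p \<in> (\<lambda>z. a + u * z) ` H"
  then show "p \<in> (\<lambda>z. a + z) ` H"
    using hex_unit_mult_in_H[OF u] by auto
next
  fix p assume "p \<in> (\<lambda>z. a + z) ` H"
  then obtain z where z: "z \<in> H" "p = a + z"
    by auto
  have "1 / u * z \<in> H"
    using hex_unit_mult_in_H z hex_units_divide one_hex_unit u by blast
  moreover have "p = a + u * (1 / u * z)"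
    using z hex_units_nonzero[OF u] by simp
  ultimately show "p \<in> (\<lambda>z. a + u * z) ` H"
    by blast
qed

lemma Re_hex_unit_mult_le:
  assumes "u \<in> hex_units" "z \<in> H"
  shows "Re (u * z) \<le> 1 / 2"
proof -
  have "H \<subseteq> {z. Re z \<le> 1 / 2}"
    unfolding H_eq
  proof (rule hull_minimal)
    show "(\<lambda>u. u * ((1 + \<omega>) / 3)) ` hex_units \<subseteq> {z. Re z \<le> 1 / 2}"
      by (auto simp: hex_units_eq omega_sq field_simps)
    show "convex {z. Re z \<le> 1 / 2}"
      by (rule convex_halfspace_Re_le)
  qed
  then show ?thesis
    using hex_unit_mult_in_H[OF assms] by blast
qed

lemma lattice_point_far:
  assumes "(m, n) \<noteq> (0, 0)"
  shows "\<exists>u\<in>hex_units. Re (u * lattice_point m n) \<ge> 1"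
proof -
  have coords: "Re (1 * lattice_point m n) = real_of_int (2 * m + n) / 2"
    "Re (\<omega> * lattice_point m n) = real_of_int (m - n) / 2"
    "Re (\<omega>\<^sup>2 * lattice_point m n) = real_of_int (- m - 2 * n) / 2"
    by (simp_all add: lattice_point_def omega_sq field_simps)
  have bound: "\<exists>u\<in>hex_units. Re (u * lattice_point m n) \<ge> 1"
    if "v \<in> hex_units" "Re (v * lattice_point m n) = real_of_int k / 2" "2 \<le> \<bar>k\<bar>" for v k
  proof (cases "k \<ge> 0")
    case True
    then show ?thesis
      using that by (intro bexI[of _ v]) linarith+
  next
    case False
    then have "Re (- v * lattice_point m n) \<ge> 1"
      using that(2,3) unfolding mult_minus_left uminus_complex.sel by linarith
    then show ?thesis
      using hex_units_minus[OF that(1)] by blast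
  qed
  \<comment> \<open>\<open>3 * m\<close> and \<open>3 * n\<close> are, up to signs, sums of two of
    these numbers; if all were at most 1 in absolute value, \<open>m\<close> and \<open>n\<close>
    would vanish.\<close>
  have "2 \<le> \<bar>2 * m + n\<bar> \<or> 2 \<le> \<bar>m - n\<bar> \<or> 2 \<le> \<bar>- m - 2 * n\<bar>"
    using assms by auto
  then show ?thesis
    using bound[OF _ coords(1)] bound[OF _ coords(2)] bound[OF _ coords(3)]
    unfolding hex_units_eq by blast
qed

text \<open>In a direction where the centres are at least 1 apart, each hexagon reaches at most 1/2
  towards the other, so they share at most points of one line.\<close>

lemma hexagons_essentially_disjoint:
  assumes "z \<in> lattice" "z' \<in> lattice" "z \<noteq> z'"
  shows "essentially_disjoint ((\<lambda>x. z + x) ` H) ((\<lambda>x. z' + x) ` H)"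
proof -
  obtain m n where mn: "z' - z = lattice_point m n"
    using lattice_diff[OF assms(2,1)] by (rule latticeE)
  then have "(m, n) \<noteq> (0, 0)"
    using assms(3) by (auto simp: lattice_point_def)
  then obtain u where u: "u \<in> hex_units" "Re (u * (z' - z)) \<ge> 1"
    using lattice_point_far mn by metis
  have "((\<lambda>x. z + x) ` H) \<inter> ((\<lambda>x. z' + x) ` H) \<subseteq> {p. cnj u \<bullet> p = 1 / 2 + Re (u * z)}"
  proof
    fix p assume "p \<in> ((\<lambda>x. z + x) ` H) \<inter> ((\<lambda>x. z' + x) ` H)"
    moreover have "p - a \<in> H" if "p \<in> (\<lambda>x. a + x) ` H" for a
      using that by auto
    ultimately have "p - z \<in> H" "p - z' \<in> H"
      by blast+
    then have "Re (u * (p - z)) \<le> 1 / 2" "Re (- u * (p - z')) \<le> 1 / 2"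
      using Re_hex_unit_mult_le u hex_units_minus by blast+
    then have "Re (u * p) = 1 / 2 + Re (u * z)"
      using u(2) unfolding right_diff_distrib mult_minus_left minus_complex.sel uminus_complex.sel
      by linarith
    then show "p \<in> {p. cnj u \<bullet> p = 1 / 2 + Re (u * z)}"
      by (simp add: inner_complex_def)
  qed
  moreover have "negligible {p. cnj u \<bullet> p = 1 / 2 + Re (u * z)}"
    using hex_units_nonzero[OF u(1)] by (intro negligible_hyperplane) simp
  ultimately show ?thesis
    unfolding essentially_disjoint_def using negligible_subset negligible_iff_null_sets by blast
qed

section \<open>Covering the plane by hexagons\<close>

lemma conic_combination_in_H:
  assumes "x \<in> H" "y \<in> H" "0 \<in> H" "0 \<le> s" "0 \<le> t" "s + t \<le> 1"
  shows "s *\<^sub>R x + t *\<^sub>R y \<in> H"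
proof -
  have "convex hull {0, x, y} \<subseteq> H"
    using assms convex_H by (intro hull_minimal) auto
  moreover have "s *\<^sub>R x + t *\<^sub>R y \<in> convex hull {0, x, y}"
    unfolding convex_hull_3 using assms
    by (intro CollectI exI[of _ "1 - s - t"] exI[of _ s] exI[of _ t]) auto
  ultimately show ?thesis
    by blast
qed

lemma vertex_in_H: "u \<in> hex_units \<Longrightarrow> u * ((1 + \<omega>) / 3) \<in> H"
  unfolding H_eq by (rule hull_inc) blast

lemma midpoint_in_H: "x \<in> H \<Longrightarrow> y \<in> H \<Longrightarrow> (x + y) / 2 \<in> H"
  using convexD[OF convex_H, of x y "1 / 2" "1 / 2"] by (simp add: scaleR_conv_of_real field_simps)

lemma zero_in_H: "0 \<in> H"
proof -
  have "(1 * ((1 + \<omega>) / 3) + - 1 * ((1 + \<omega>) / 3)) / 2 \<in> H"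
    by (intro midpoint_in_H vertex_in_H hex_units_minus one_hex_unit)
  then show ?thesis
    unfolding mult_minus_left mult_1 right_minus div_0 .
qed

lemma half_in_H: "1 / 2 \<in> H"
proof -
  have "- (\<omega>\<^sup>2) \<in> hex_units"
    by (simp add: hex_units_eq)
  moreover have "(1 * ((1 + \<omega>) / 3) + - (\<omega>\<^sup>2) * ((1 + \<omega>) / 3)) / 2 = 1 / 2"
    by (simp add: omega_sq omega_mult field_simps)
  ultimately show ?thesis
    using midpoint_in_H[OF vertex_in_H[OF one_hex_unit] vertex_in_H] by metis
qed

text \<open>The region is the quadrilateral with corners \<open>0\<close>, \<open>1 / 2\<close>,
  \<open>(1 + \<omega>) / 3\<close>, \<open>\<omega> / 2\<close>; the diagonal from \<open>0\<close>
  cuts it into two triangles with corners in \<open>H\<close>.\<close>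

lemma sector_in_H:
  assumes "0 \<le> b" "0 \<le> c" "2 * b + c \<le> 1" "b + 2 * c \<le> 1"
  shows "of_real b + of_real c * \<omega> \<in> H"
proof -
  have v: "(1 + \<omega>) / 3 \<in> H"
    using vertex_in_H[OF one_hex_unit] by simp
  show ?thesis
  proof (cases "c \<le> b")
    case True
    have "(2 * (b - c)) *\<^sub>R (1 / 2) + (3 * c) *\<^sub>R ((1 + \<omega>) / 3) \<in> H"
      using True assms by (intro conic_combination_in_H half_in_H v zero_in_H) auto
    moreover have "(2 * (b - c)) *\<^sub>R (1 / 2) + (3 * c) *\<^sub>R ((1 + \<omega>) / 3) = of_real b + of_real c * \<omega>"
      by (simp add: scaleR_conv_of_real field_simps)
    ultimately show ?thesis by simp
  next
    case False
    have "(2 * (c - b)) *\<^sub>R (\<omega> * (1 / 2)) + (3 * b) *\<^sub>R ((1 + \<omega>) / 3) \<in> H"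
      using False assms
      by (intro conic_combination_in_H hex_unit_mult_in_H omega_hex_unit half_in_H v zero_in_H) auto
    moreover have "(2 * (c - b)) *\<^sub>R (\<omega> * (1 / 2)) + (3 * b) *\<^sub>R ((1 + \<omega>) / 3) =
        of_real b + of_real c * \<omega>"
      by (simp add: scaleR_conv_of_real field_simps)
    ultimately show ?thesis by simp
  qed
qed

text \<open>The triangle \<open>0\<close>, \<open>1\<close>, \<open>\<omega>\<close> splits into
  three such quadrilaterals, one at each corner. The rotation about its centroid permutes them and
  cycles the coordinates \<open>1 - x - y\<close>, \<open>x\<close>, \<open>y\<close>.\<close>

lemma triangle_covered:
  assumes "0 \<le> x" "0 \<le> y" "x + y \<le> 1"
  shows "\<exists>z\<in>lattice. of_real x + of_real y * \<omega> - z \<in> H"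
proof -
  consider "2 * x + y \<le> 1" "x + 2 * y \<le> 1" | "1 \<le> 2 * x + y" "y \<le> x" | "1 \<le> x + 2 * y" "x \<le> y"
    by linarith
  then show ?thesis
  proof cases
    case 1
    then show ?thesis
      using sector_in_H assms zero_in_lattice by (intro bexI[of _ 0]) auto
  next
    case 2
    have "\<omega>\<^sup>2 * (of_real y + of_real (1 - x - y) * \<omega>) \<in> H"
      using assms 2 by (intro hex_unit_mult_in_H sector_in_H) (auto simp: hex_units_eq)
    moreover have "\<omega>\<^sup>2 * (of_real y + of_real (1 - x - y) * \<omega>) =
        of_real x + of_real y * \<omega> - lattice_point 1 0"
      using omega_sq unfolding lattice_point_def of_real_diff of_real_1 of_int_1 of_int_0 by algebra
    ultimately show ?thesis
      using lattice_point_in by metis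
  next
    case 3
    have "- \<omega> * (of_real (1 - x - y) + of_real x * \<omega>) \<in> H"
      using assms 3 by (intro hex_unit_mult_in_H sector_in_H) (auto simp: hex_units_eq)
    moreover have "- \<omega> * (of_real (1 - x - y) + of_real x * \<omega>) =
        of_real x + of_real y * \<omega> - lattice_point 0 1"
      using omega_sq unfolding lattice_point_def of_real_diff of_real_1 of_int_1 of_int_0 by algebra
    ultimately show ?thesis
      using lattice_point_in by metis
  qed
qed

lemma plane_covered: "\<exists>z\<in>lattice. p - z \<in> H"
proof -
  define y where "y = 2 * Im p / sqrt 3"
  define x where "x = Re p - y / 2"
  have p: "p = lattice_point \<lfloor>x\<rfloor> \<lfloor>y\<rfloor> + (of_real (frac x) + of_real (frac y) * \<omega>)"
    by (simp add: complex_eq_iff lattice_point_def x_def y_def frac_def field_simps)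
  have f: "0 \<le> frac x" "frac x \<le> 1" "0 \<le> frac y" "frac y \<le> 1"
    using frac_lt_1 less_imp_le by auto
  show ?thesis
  proof (cases "frac x + frac y \<le> 1")
    case True
    then obtain z where "z \<in> lattice" "of_real (frac x) + of_real (frac y) * \<omega> - z \<in> H"
      using triangle_covered f by blast
    moreover have "p - (lattice_point \<lfloor>x\<rfloor> \<lfloor>y\<rfloor> + z) = of_real (frac x) + of_real (frac y) * \<omega> - z"
      by (subst p) simp
    ultimately show ?thesis
      using lattice_add lattice_point_in by metis
  next
    case False
    then obtain z where z: "z \<in> lattice" "of_real (1 - frac x) + of_real (1 - frac y) * \<omega> - z \<in> H"
      using triangle_covered[of "1 - frac x" "1 - frac y"] f by auto
    \<comment> \<open>The other half of the fundamental parallelogram is the image of the first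
      under the half turn about its centre.\<close>
    then have "- 1 * (of_real (1 - frac x) + of_real (1 - frac y) * \<omega> - z) \<in> H"
      by (intro hex_unit_mult_in_H hex_units_minus one_hex_unit)
    moreover have "p - (lattice_point \<lfloor>x\<rfloor> \<lfloor>y\<rfloor> + (lattice_point 1 1 - z)) =
        - 1 * (of_real (1 - frac x) + of_real (1 - frac y) * \<omega> - z)"
      by (subst p) (simp add: lattice_point_def algebra_simps)
    ultimately show ?thesis
      using lattice_add lattice_diff lattice_point_in z(1) by metis
  qed
qed

section \<open>Rigidity of the hexagon and of the chord\<close>

lemma H_translation_rigid:
  assumes "(\<lambda>x. a + x) ` H = (\<lambda>x. b + x) ` H"
  shows "a = b"
proof -
  have step: "x + (a - b) \<in> H" if "x \<in> H" for x
  proof -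
    have "a + x \<in> (\<lambda>x. b + x) ` H"
      using that assms by blast
    then show ?thesis
      by (auto simp: algebra_simps)
  qed
  \<comment> \<open>Iterating the translation from 0 would leave the bounded set \<open>H\<close> if
    \<open>a\<close> and \<open>b\<close> differed.\<close>
  have "of_nat k * (a - b) \<in> H" for k
  proof (induction k)
    case 0
    then show ?case by (simp add: zero_in_H)
  next
    case (Suc k)
    then show ?case using step[of "of_nat k * (a - b)"] by (simp add: algebra_simps)
  qed
  moreover obtain B where B: "\<And>x. x \<in> H \<Longrightarrow> cmod x \<le> B"
    using compact_H compact_imp_bounded bounded_iff by metis
  ultimately have "of_nat k * cmod (a - b) \<le> B" for k :: nat
    by (metis norm_mult norm_of_nat)
  then show ?thesis
    by (metis reals_Archimedean3 linorder_not_less norm_le_zero_iff eq_iff_diff_eq_0)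
qed

text \<open>The chord misses the centre, so its midpoint is nonzero and reveals the rotation. The
  sum of the endpoints is used because a segment determines them only up to order.\<close>

lemma chord_rigid:
  assumes "c \<in> marking_chords" and eq: "(\<lambda>z. a + u * z) ` c = (\<lambda>z. a + v * z) ` c"
  shows "u = v"
proof -
  obtain p q where c: "c = closed_segment p q" and pq: "Re (p + q) \<noteq> 0"
  proof -
    have "Re (hex_vertex (- pi / 6) + hex_vertex (pi / 2)) \<noteq> 0"
      by (simp add: hex_vertex_def Re_exp cos_30)
    moreover have "Re (hex_vertex (5 * pi / 6) + hex_vertex (3 * pi / 2)) \<noteq> 0"
    proof -
      have "5 * pi / 6 = pi - pi / 6" "3 * pi / 2 = 3 / 2 * pi"
        by simp_all
      then have "cos (5 * pi / 6) = - (sqrt 3 / 2)" "cos (3 * pi / 2) = 0"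
        by (simp_all only: cos_pi_minus cos_30 cos_3over2_pi)
      then show ?thesis
        by (simp add: hex_vertex_def Re_exp)
    qed
    ultimately show thesis
      using assms(1) that unfolding marking_chords_def by blast
  qed
  have "(\<lambda>z. a + w * z) ` closed_segment p q = closed_segment (a + w * p) (a + w * q)" for w
  proof -
    have "linear ((*) w)"
      by (simp add: linear_times)
    then have "closed_segment (w * p) (w * q) = (*) w ` closed_segment p q"
      by (rule closed_segment_linear_image)
    then show ?thesis
      by (simp add: closed_segment_translation image_image)
  qed
  then have "{a + u * p, a + u * q} = {a + v * p, a + v * q}"
    using eq by (simp add: c closed_segment_eq)
  then have "(a + u * p) + (a + u * q) = (a + v * p) + (a + v * q)"
    by (auto simp: doubleton_eq_iff)
  then have "u * (p + q) = v * (p + q)"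
    by (simp add: algebra_simps)
  moreover have "p + q \<noteq> 0"
    using pq by (metis zero_complex.sel(1))
  ultimately show ?thesis
    by simp
qed

subsection \<open>The marked tiling\<close>

lemma tile_inj:
  assumes "c \<in> marking_chords" "u \<in> hex_units" "v \<in> hex_units"
    and eq: "tile c (a, u) = tile c (b, v)"
  shows "a = b" "u = v"
proof -
  have "(\<lambda>z. a + u * z) ` H = (\<lambda>z. b + v * z) ` H"
    and c: "(\<lambda>z. a + u * z) ` c = (\<lambda>z. b + v * z) ` c"
    using eq by (simp_all add: tile_def place_def)
  then show "a = b"
    unfolding hex_unit_image_H[OF assms(2)] hex_unit_image_H[OF assms(3)]
    by (intro H_translation_rigid)
  then show "u = v"
    using c chord_rigid[OF assms(1)] by blast
qed

lemma fst_tile: "u \<in> hex_units \<Longrightarrow> fst (tile c (z, u)) = (\<lambda>x. z + x) ` H"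
  by (simp add: tile_def place_def hex_unit_image_H)

lemma tilesD: "(z, u) \<in> tiles \<Longrightarrow> z \<in> lattice" "(z, u) \<in> tiles \<Longrightarrow> u \<in> hex_units"
  using tiles_subset by auto

lemma marked_tiling_P_inf: "marked_tiling c (P_inf c)"
proof -
  have "T \<in> marked_hexagons c \<and> congruent_copy H (fst T)" if TP: "T \<in> P_inf c" for T
  proof -
    obtain z u where zu: "(z, u) \<in> tiles" and T: "T = tile c (z, u)"
      using TP by (auto simp: P_inf_eq)
    have "cmod u = 1"
      using norm_hex_unit tilesD(2)[OF zu] .
    then show ?thesis
      unfolding T marked_hexagons_def congruent_copy_def tile_def by (auto simp: place_def)
  qed
  moreover have "(\<Union>T\<in>P_inf c. fst T) = UNIV"
  proof -
    have "p \<in> (\<Union>T\<in>P_inf c. fst T)" for p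
    proof -
      obtain z u where z: "p - z \<in> H" and zu: "(z, u) \<in> tiles"
        using plane_covered tiles_cover by blast
      have "p = z + (p - z)"
        by simp
      then have "p \<in> fst (tile c (z, u))"
        unfolding fst_tile[OF tilesD(2)[OF zu]] using z by blast
      moreover have "tile c (z, u) \<in> P_inf c"
        using zu by (simp add: P_inf_eq)
      ultimately show ?thesis
        by blast
    qed
    then show ?thesis
      by blast
  qed
  moreover have "essentially_disjoint (fst S) (fst T)"
    if ST: "S \<in> P_inf c" "T \<in> P_inf c" "S \<noteq> T" for S T
  proof -
    obtain z u where zu: "(z, u) \<in> tiles" and S: "S = tile c (z, u)"
      using ST(1) by (auto simp: P_inf_eq)
    obtain z' u' where zu': "(z', u') \<in> tiles" and T: "T = tile c (z', u')"
      using ST(2) by (auto simp: P_inf_eq)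
    \<comment> \<open>Distinct marked hexagons cannot share a centre, since the centre determines
      the orientation.\<close>
    have "z \<noteq> z'"
      using tiles_unique[OF zu] zu' ST(3) S T by blast
    then show ?thesis
      unfolding S T fst_tile[OF tilesD(2)[OF zu]] fst_tile[OF tilesD(2)[OF zu']]
      by (intro hexagons_essentially_disjoint tilesD(1)[OF zu] tilesD(1)[OF zu'])
  qed
  ultimately show ?thesis
    unfolding marked_tiling_def tiling_by_copies_def by blast
qed

lemma aperiodic_P_inf:
  assumes "c \<in> marking_chords"
  shows "aperiodic (P_inf c)"
proof -
  have "t = 0" if t: "place t 1 ` P_inf c = P_inf c" for t
  proof (rule no_period)
    fix z u assume zu: "(z, u) \<in> tiles"
    have "place t 1 (tile c (z, u)) = tile c (t + z, u)"
      by (simp add: tile_def place_place)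
    moreover have "place t 1 (tile c (z, u)) \<in> P_inf c"
      using zu t unfolding P_inf_eq by blast
    ultimately obtain z' u' where zu': "(z', u') \<in> tiles" "tile c (t + z, u) = tile c (z', u')"
      unfolding P_inf_eq by auto
    then have "t + z = z'" "u = u'"
      using tile_inj[OF assms tilesD(2)[OF zu] tilesD(2)[OF zu'(1)]] by blast+
    then show "(z + t, u) \<in> tiles"
      using zu' by (simp add: add.commute)
  qed
  then show ?thesis
    unfolding aperiodic_def by blast
qed

theorem mainTheorem1:
  fixes c :: "complex set"
  assumes "c \<in> marking_chords"
  shows "marked_tiling c (P_inf c) \<and> aperiodic (P_inf c)"
  using marked_tiling_P_inf aperiodic_P_inf[OF assms] ..

end
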